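(* Let $\alpha_{ij}$ ($1\le i,j\le3$), $\alpha_1,\alpha_2,\alpha_3$ be constants and let sequences $(a_x),(b_x),(c_x)$, $x\ge0$, satisfy for $x\ge1$ \[ \begin{aligned} a_x&=\alpha_{11}a_{x-1}+\alpha_{12}b_{x-1}+\alpha_{13}c_{x-1}+\alpha_1,\\ b_x&=\alpha_{21}a_{x-1}+\alpha_{22}b_{x-1}+\alpha_{23}c_{x-1}+\alpha_2,\\ c_x&=\alpha_{31}a_{x-1}+\alpha_{32}b_{x-1}+\alpha_{33}c_{x-1}+\alpha_3 . \end{aligned} \] Assume (1) $\alpha_{11}+\alpha_{12}+\alpha_{13}=\alpha_{21}+\alpha_{22}+\alpha_{23}=\alpha_{31}+\alpha_{32}+\alpha_{33}$ and (2) there exist $w_1,w_2$ with $w_1+w_2=1$, $w_2\neq0$, such that $b_x=w_1a_x+w_2c_x$ for all $x$. Put $C_1=\alpha_{11}+\alpha_{12}+\alpha_{13}$, $C_2=\alpha_{12}+\frac1{w_2}\alpha_{13}$, $C_3=\alpha_{11}-\frac{w_1}{w_2}\alpha_{13}-\alpha_{21}+\frac{w_1}{w_2}\alpha_{23}$, $C_4=\alpha_{12}+\frac1{w_2}\alpha_{13}+\alpha_{21}-\frac{w_1}{w_2}\alpha_{23}$, $C_5=\alpha_{21}-\frac{w_1}{w_2}\alpha_{23}$. Then in all cases $c_x=-\frac{w_1}{w_2}a_x+\frac1{w_2}b_x$, and: 1. If $C_4\neq0$, $C_1\neq1$, $C_3\neq1$: \[ a_x=C_1^xa_0+C_2\frac{C_1^x-C_3^x}{C_4}(b_0-a_0)+\alpha_1\frac{C_1^x-1}{C_1-1}+\frac{(\alpha_2-\alpha_1)C_2}{C_4}\left(\frac{C_1^x-C_1}{C_1-1}-\frac{C_3^x-C_3}{C_3-1}\right),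 \] \[ b_x=C_1^xb_0+C_5\frac{C_1^x-C_3^x}{C_4}(a_0-b_0)+\alpha_2\frac{C_1^x-1}{C_1-1}+\frac{(\alpha_1-\alpha_2)C_5}{C_4}\left(\frac{C_1^x-C_1}{C_1-1}-\frac{C_3^x-C_3}{C_3-1}\right). \] 2. If $C_4\neq0$, $C_1=1$ (so $C_3\ne1$): \[ a_x=C_1^xa_0+C_2\frac{C_1^x-C_3^x}{C_4}(b_0-a_0)+\alpha_1x+\frac{(\alpha_2-\alpha_1)C_2}{C_3-1}\left(\frac{C_3^x-C_3}{C_3-1}-x+1\right), \] \[ b_x=C_1^xb_0+C_5\frac{C_1^x-C_3^x}{C_4}(a_0-b_0)+\alpha_2x+\frac{(\alpha_1-\alpha_2)C_5}{C_3-1}\left(\frac{C_3^x-C_3}{C_3-1}-x+1\right). \] 3. If $C_4\neq0$, $C_3=1$ (so $C_1\neq1$): \[ a_x=C_1^xa_0+C_2\frac{C_1^x-C_3^x}{C_4}(b_0-a_0)+\alpha_1\frac{C_1^x-1}{C_1-1}+\frac{(\alpha_2-\alpha_1)C_2}{C_1-1}\left(\frac{C_1^x-C_1}{C_1-1}-x+1\right), \] \[ b_x=C_1^xb_0+C_5\frac{C_1^x-C_3^x}{C_4}(a_0-b_0)+\alpha_2\frac{C_1^x-1}{C_1-1}+\frac{(\alpha_1-\alpha_2)C_5}{C_1-1}\left(\frac{C_1^x-C_1}{C_1-1}-x+1\right). \] 4. If $C_4=0$, $C_1\neq1$: \[ a_x=C_1^{x-1}\big(C_1a_0+C_2(b_0-a_0)x\big)+\alpha_1\frac{C_1^x-1}{C_1-1}+\frac{(\alpha_2-\alpha_1)C_2}{(C_1-1)^2}\big((x-1)C_1^x-xC_1^{x-1}+1\big),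 \] \[ b_x=C_1^{x-1}\big(C_1b_0+C_5(a_0-b_0)x\big)+\alpha_2\frac{C_1^x-1}{C_1-1}+\frac{(\alpha_1-\alpha_2)C_5}{(C_1-1)^2}\big((x-1)C_1^x-xC_1^{x-1}+1\big). \] 5. If $C_4=0$, $C_1=1$: \[ a_x=C_1^{x-1}\big(C_1a_0+C_2(b_0-a_0)x\big)+\alpha_1x+C_2(\alpha_2-\alpha_1)\frac{x(x-1)}2, \] \[ b_x=C_1^{x-1}\big(C_1b_0+C_5(a_0-b_0)x\big)+\alpha_2x+C_5(\alpha_1-\alpha_2)\frac{x(x-1)}2. \]
   Context: $x$ is a nonnegative integer index and $a_0,b_0,c_0$ are the initial values; all other symbols are constants.
   Formalization: In case 4, when C_1 = 0 the formulas are claimed only for x ≥ 1, since at x = 0 they contain the undefined expression 0^{-1}. *)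

theory Defs
  imports Complex_Main
begin

end

theory Submission
  imports Defs
begin

text \<open>
  Eliminating $c$ leaves a two-dimensional affine system whose matrix has row sums $C_1$.
  The difference $d = b - a$ then satisfies the scalar recurrence $d_{x+1} = C_3 d_x + (\alpha_2 - \alpha_1)$,
  and $a_{x+1} = C_1 a_x + C_2 d_x + \alpha_1$; the formulas for $b$ follow by exchanging the roles of $a$ and $b$.
  Since $C_4 = C_1 - C_3$, the five cases distinguish which of $C_1$, $C_3$, $1$ coincide.
\<close>

text \<open>
  The closed form of the solution depends on the coincidences among $r$, $q$, $1$ only through
  these four responses, taken from zero initial values, of the recurrences for $d$ and $a$.
\<close>

definition zero_state_responses ::
    "'a::comm_ring_1 \<Rightarrow> 'a \<Rightarrow> (nat \<Rightarrow> 'a) \<Rightarrow> (nat \<Rightarrow> 'a) \<Rightarrow> (nat \<Rightarrow> 'a) \<Rightarrow> (nat \<Rightarrow> 'a) \<Rightarrow> bool" where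
  "zero_state_responses r q K G F H \<longleftrightarrow>
    K 0 = 0 \<and> (\<forall>n. K (Suc n) = r * K n + 1) \<and>
    G 0 = 0 \<and> (\<forall>n. G (Suc n) = q * G n + 1) \<and>
    F 0 = 0 \<and> (\<forall>n. F (Suc n) = r * F n + q ^ n) \<and>
    H 0 = 0 \<and> (\<forall>n. H (Suc n) = r * H n + G n)"

text \<open>Superposition: \<open>K\<close> answers the constant input 1, \<open>F\<close> the free
  mode \<open>q ^ n\<close> of \<open>d\<close>, and \<open>H\<close> the part \<open>G\<close> that
  the constant \<open>e\<close> excites in \<open>d\<close>.\<close>

lemma cascade_solution:
  fixes u d :: "nat \<Rightarrow> 'a::comm_ring_1"
  assumes u: "\<And>n. u (Suc n) = r * u n + p * d n + s"
    and d: "\<And>n. d (Suc n) = q * d n + e"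
    and resp: "zero_state_responses r q K G F H"
  shows "u n = r ^ n * u 0 + p * F n * d 0 + s * K n + e * p * H n"
proof -
  note resp = resp[unfolded zero_state_responses_def]
  have d_eq: "d n = q ^ n * d 0 + e * G n" for n
    by (induction n) (simp_all add: d resp algebra_simps)
  show ?thesis
  proof (induction n)
    case 0
    show ?case by (simp add: resp)
  next
    case (Suc n)
    then show ?case by (simp add: u d_eq[of n] resp algebra_simps)
  qed
qed

text \<open>Both rows sum to \<open>r\<close>, so putting b = a + d turns the first row into
  \<open>r * a n + p * d n + s\<close>, while d has multiplier \<open>r - p - p'\<close>. That
  multiplier is symmetric in \<open>p\<close> and \<open>p'\<close>, so the same responses serve for
  b, driven by a - b.\<close>

lemma equal_row_sum_system_solution:
  fixes a b :: "nat \<Rightarrow> 'a::comm_ring_1"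
  assumes a: "\<And>n. a (Suc n) = (r - p) * a n + p * b n + s"
    and b: "\<And>n. b (Suc n) = p' * a n + (r - p') * b n + t"
    and q: "q = r - p - p'"
    and resp: "zero_state_responses r q K G F H"
  shows "a n = r ^ n * a 0 + p * F n * (b 0 - a 0) + s * K n + (t - s) * p * H n"
    and "b n = r ^ n * b 0 + p' * F n * (a 0 - b 0) + t * K n + (s - t) * p' * H n"
proof -
  show "a n = r ^ n * a 0 + p * F n * (b 0 - a 0) + s * K n + (t - s) * p * H n"
    by (rule cascade_solution[where d = "\<lambda>n. b n - a n", OF _ _ resp])
       (simp_all add: a b q algebra_simps)
  show "b n = r ^ n * b 0 + p' * F n * (a 0 - b 0) + t * K n + (s - t) * p' * H n"
    by (rule cascade_solution[where d = "\<lambda>n. a n - b n", OF _ _ resp])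
       (simp_all add: a b q algebra_simps)
qed

text \<open>Brings the quotients of the theorem into a shape to which \<open>geometric_step\<close>
  applies.\<close>

lemma geometric_tail:
  fixes r :: "'a::field"
  assumes "r \<noteq> 1"
  shows "(r ^ n - r) / (r - 1) = (r ^ n - 1) / (r - 1) - 1"
  using assms by (simp add: divide_simps)

lemma geometric_step:
  fixes r :: "'a::field"
  assumes "r \<noteq> 1"
  shows "(r ^ Suc n - 1) / (r - 1) = r * ((r ^ n - 1) / (r - 1)) + 1"
  using assms by (simp add: divide_simps) (simp add: algebra_simps)

lemma power_difference_step:
  fixes r :: "'a::field"
  assumes "r \<noteq> q"
  shows "(r ^ Suc n - q ^ Suc n) / (r - q) = r * ((r ^ n - q ^ n) / (r - q)) + q ^ n"
  using assms by (simp add: divide_simps) (simp add: algebra_simps)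

lemma responses_distinct:
  fixes r :: "'a::field"
  assumes "r \<noteq> q" "r \<noteq> 1" "q \<noteq> 1"
  shows "zero_state_responses r q
    (\<lambda>n. (r ^ n - 1) / (r - 1)) (\<lambda>n. (q ^ n - 1) / (q - 1))
    (\<lambda>n. (r ^ n - q ^ n) / (r - q))
    (\<lambda>n. ((r ^ n - r) / (r - 1) - (q ^ n - q) / (q - 1)) / (r - q))"
proof -
  \<comment> \<open>For x = \<open>K n\<close> and y = \<open>G n\<close> this is the step of H = (K
    - G) / (r - q): the two offsets -1 of the tails cancel, and so do the increments +1 of K and
    G.\<close>
  have "(r * x - q * y) / (r - q) = r * ((x - y) / (r - q)) + y" for x y
    using assms by (simp add: divide_simps) (simp add: algebra_simps)
  with assms show ?thesis
    by (simp add: zero_state_responses_def geometric_tail geometric_step power_difference_step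
        del: power_Suc times_divide_eq_right)
qed

lemma responses_first_one:
  fixes q :: "'a::field"
  assumes "q \<noteq> 1"
  shows "zero_state_responses 1 q
    of_nat (\<lambda>n. (q ^ n - 1) / (q - 1))
    (\<lambda>n. (1 ^ n - q ^ n) / (1 - q))
    (\<lambda>n. ((q ^ n - q) / (q - 1) - of_nat n + 1) / (q - 1))"
proof -
  \<comment> \<open>Here K n = n and H n = (G n - n) / (q - 1), the +1 cancelling the offset of the
    tail; x stands for G n and m for n.\<close>
  have "(q * x - m) / (q - 1) = (x - m) / (q - 1) + x" for x m
    using assms by (simp add: divide_simps) (simp add: algebra_simps)
  with assms show ?thesis
    using power_difference_step[of 1 q]
    by (simp add: zero_state_responses_def geometric_tail geometric_step del: power_Suc times_divide_eq_right)
qed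

lemma responses_second_one:
  fixes r :: "'a::field"
  assumes "r \<noteq> 1"
  shows "zero_state_responses r 1
    (\<lambda>n. (r ^ n - 1) / (r - 1)) of_nat
    (\<lambda>n. (r ^ n - 1 ^ n) / (r - 1))
    (\<lambda>n. ((r ^ n - r) / (r - 1) - of_nat n + 1) / (r - 1))"
proof -
  \<comment> \<open>Now G n = n and H n = (K n - n) / (r - 1); x stands for K n and m for n.\<close>
  have "(r * x - m) / (r - 1) = r * ((x - m) / (r - 1)) + m" for x m
    using assms by (simp add: divide_simps) (simp add: algebra_simps)
  with assms show ?thesis
    by (simp add: zero_state_responses_def geometric_tail geometric_step del: power_Suc times_divide_eq_right)
qed

text \<open>The confluent limit of the distinct case as q tends to r: \<open>F\<close> is the formal
  derivative in r of \<open>r ^ n\<close>, and \<open>H\<close> that of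
  \<open>(r ^ n - 1) / (r - 1)\<close>.\<close>

lemma responses_double:
  fixes r :: "'a::field"
  assumes "r \<noteq> 1"
  shows "zero_state_responses r r
    (\<lambda>n. (r ^ n - 1) / (r - 1)) (\<lambda>n. (r ^ n - 1) / (r - 1))
    (\<lambda>n. of_nat n * r ^ (n - 1))
    (\<lambda>n. ((of_nat n - 1) * r ^ n - of_nat n * r ^ (n - 1) + 1) / (r - 1) ^ 2)"
proof -
  \<comment> \<open>At n = 0 the exponent \<open>n - 1\<close> truncates to 0, but the factor
    \<open>of_nat n\<close> removes that term.\<close>
  have F: "of_nat (Suc n) * r ^ (Suc n - 1) = r * (of_nat n * r ^ (n - 1)) + r ^ n" for n
    by (cases n) (simp_all add: algebra_simps)
  have "((of_nat (Suc n) - 1) * r ^ Suc n - of_nat (Suc n) * r ^ (Suc n - 1) + 1) / (r - 1) ^ 2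
    = r * (((of_nat n - 1) * r ^ n - of_nat n * r ^ (n - 1) + 1) / (r - 1) ^ 2)
      + (r ^ n - 1) / (r - 1)" for n
    unfolding F using assms
    by (simp add: divide_simps power2_eq_square) (simp add: algebra_simps)
  with F geometric_step[OF assms] show ?thesis
    unfolding zero_state_responses_def by simp
qed

lemma responses_double_one:
  "zero_state_responses (1 :: 'a::field_char_0) 1
    of_nat of_nat of_nat (\<lambda>n. of_nat n * (of_nat n - 1) / 2)"
  by (simp add: zero_state_responses_def field_simps)

text \<open>Passes from the integer exponent of the theorem, which is -1 at index 0, to the
  truncated one of \<open>responses_double\<close>. For n = 0 and r = 0 the first identity would
  fail, as \<open>0 powi -1\<close> is 0.\<close>

lemma powi_diff_one:
  fixes r :: "'a::field"
  assumes "n \<ge> 1 \<or> r \<noteq> 0"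
  shows "r powi (int n - 1) * (r * u + v * of_nat n) = r ^ n * u + v * (of_nat n * r ^ (n - 1))"
    and "of_nat n * r powi (int n - 1) = of_nat n * r ^ (n - 1)"
  using assms by (cases n; simp add: power_int_minus algebra_simps)+

theorem theorem1:
  fixes \<alpha>11 \<alpha>12 \<alpha>13 \<alpha>21 \<alpha>22 \<alpha>23 \<alpha>31 \<alpha>32 \<alpha>33 :: "'a::field_char_0"
    and \<alpha>1 \<alpha>2 \<alpha>3 :: 'a
    and a b c :: "nat \<Rightarrow> 'a"
    and w1 w2 C1 C2 C3 C4 C5 :: 'a
  assumes rec_a: "\<forall>x\<ge>1. a x = \<alpha>11 * a (x - 1) + \<alpha>12 * b (x - 1) + \<alpha>13 * c (x - 1) + \<alpha>1"
    and rec_b: "\<forall>x\<ge>1. b x = \<alpha>21 * a (x - 1) + \<alpha>22 * b (x - 1) + \<alpha>23 * c (x - 1) + \<alpha>2"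
    and rec_c: "\<forall>x\<ge>1. c x = \<alpha>31 * a (x - 1) + \<alpha>32 * b (x - 1) + \<alpha>33 * c (x - 1) + \<alpha>3"
    and row_sums: "\<alpha>11 + \<alpha>12 + \<alpha>13 = \<alpha>21 + \<alpha>22 + \<alpha>23"
      "\<alpha>21 + \<alpha>22 + \<alpha>23 = \<alpha>31 + \<alpha>32 + \<alpha>33"
    and weights: "w1 + w2 = 1" "w2 \<noteq> 0" "\<forall>x. b x = w1 * a x + w2 * c x"
    and C1: "C1 = \<alpha>11 + \<alpha>12 + \<alpha>13"
    and C2: "C2 = \<alpha>12 + 1 / w2 * \<alpha>13"
    and C3: "C3 = \<alpha>11 - w1 / w2 * \<alpha>13 - \<alpha>21 + w1 / w2 * \<alpha>23"
    and C4: "C4 = \<alpha>12 + 1 / w2 * \<alpha>13 + \<alpha>21 - w1 / w2 * \<alpha>23"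
    and C5: "C5 = \<alpha>21 - w1 / w2 * \<alpha>23"
  shows
    "(\<forall>x. c x = - (w1 / w2) * a x + 1 / w2 * b x) \<and>
     (C4 \<noteq> 0 \<and> C1 \<noteq> 1 \<and> C3 \<noteq> 1 \<longrightarrow>
       (\<forall>x.
         a x = C1 ^ x * a 0 + C2 * ((C1 ^ x - C3 ^ x) / C4) * (b 0 - a 0)
           + \<alpha>1 * ((C1 ^ x - 1) / (C1 - 1))
           + (\<alpha>2 - \<alpha>1) * C2 / C4 * ((C1 ^ x - C1) / (C1 - 1) - (C3 ^ x - C3) / (C3 - 1)) \<and>
         b x = C1 ^ x * b 0 + C5 * ((C1 ^ x - C3 ^ x) / C4) * (a 0 - b 0)
           + \<alpha>2 * ((C1 ^ x - 1) / (C1 - 1))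
           + (\<alpha>1 - \<alpha>2) * C5 / C4 * ((C1 ^ x - C1) / (C1 - 1) - (C3 ^ x - C3) / (C3 - 1)))) \<and>
     (C4 \<noteq> 0 \<and> C1 = 1 \<longrightarrow>
       C3 \<noteq> 1 \<and>
       (\<forall>x.
         a x = C1 ^ x * a 0 + C2 * ((C1 ^ x - C3 ^ x) / C4) * (b 0 - a 0)
           + \<alpha>1 * of_nat x
           + (\<alpha>2 - \<alpha>1) * C2 / (C3 - 1) * ((C3 ^ x - C3) / (C3 - 1) - of_nat x + 1) \<and>
         b x = C1 ^ x * b 0 + C5 * ((C1 ^ x - C3 ^ x) / C4) * (a 0 - b 0)
           + \<alpha>2 * of_nat x
           + (\<alpha>1 - \<alpha>2) * C5 / (C3 - 1) * ((C3 ^ x - C3) / (C3 - 1) - of_nat x + 1))) \<and>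
     (C4 \<noteq> 0 \<and> C3 = 1 \<longrightarrow>
       C1 \<noteq> 1 \<and>
       (\<forall>x.
         a x = C1 ^ x * a 0 + C2 * ((C1 ^ x - C3 ^ x) / C4) * (b 0 - a 0)
           + \<alpha>1 * ((C1 ^ x - 1) / (C1 - 1))
           + (\<alpha>2 - \<alpha>1) * C2 / (C1 - 1) * ((C1 ^ x - C1) / (C1 - 1) - of_nat x + 1) \<and>
         b x = C1 ^ x * b 0 + C5 * ((C1 ^ x - C3 ^ x) / C4) * (a 0 - b 0)
           + \<alpha>2 * ((C1 ^ x - 1) / (C1 - 1))
           + (\<alpha>1 - \<alpha>2) * C5 / (C1 - 1) * ((C1 ^ x - C1) / (C1 - 1) - of_nat x + 1))) \<and>
     (C4 = 0 \<and> C1 \<noteq> 1 \<longrightarrow>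
       (\<forall>x. x \<ge> 1 \<or> C1 \<noteq> 0 \<longrightarrow>
         a x = C1 powi (int x - 1) * (C1 * a 0 + C2 * (b 0 - a 0) * of_nat x)
           + \<alpha>1 * ((C1 ^ x - 1) / (C1 - 1))
           + (\<alpha>2 - \<alpha>1) * C2 / (C1 - 1) ^ 2
             * ((of_nat x - 1) * C1 ^ x - of_nat x * C1 powi (int x - 1) + 1) \<and>
         b x = C1 powi (int x - 1) * (C1 * b 0 + C5 * (a 0 - b 0) * of_nat x)
           + \<alpha>2 * ((C1 ^ x - 1) / (C1 - 1))
           + (\<alpha>1 - \<alpha>2) * C5 / (C1 - 1) ^ 2
             * ((of_nat x - 1) * C1 ^ x - of_nat x * C1 powi (int x - 1) + 1))) \<and>
     (C4 = 0 \<and> C1 = 1 \<longrightarrow>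
       (\<forall>x.
         a x = C1 powi (int x - 1) * (C1 * a 0 + C2 * (b 0 - a 0) * of_nat x)
           + \<alpha>1 * of_nat x
           + C2 * (\<alpha>2 - \<alpha>1) * (of_nat x * (of_nat x - 1) / 2) \<and>
         b x = C1 powi (int x - 1) * (C1 * b 0 + C5 * (a 0 - b 0) * of_nat x)
           + \<alpha>2 * of_nat x
           + C5 * (\<alpha>1 - \<alpha>2) * (of_nat x * (of_nat x - 1) / 2)))"
proof -
  have c: "\<forall>x. c x = - (w1 / w2) * a x + 1 / w2 * b x"
    using weights by (simp add: field_simps)
  have w1: "w1 / w2 = 1 / w2 - 1"
    using weights(2) by (simp add: eq_diff_eq[THEN iffD2, OF weights(1)] diff_divide_distrib)
  \<comment> \<open>Substituting for c preserves row sums because (1 - w1) / w2 = 1. So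
    \<open>C1\<close> minus the off-diagonal entry \<open>C2\<close> or \<open>C5\<close> is the
    diagonal entry.\<close>
  have coeffs: "C1 - C2 = \<alpha>11 - w1 / w2 * \<alpha>13" "C1 - C5 = \<alpha>22 + 1 / w2 * \<alpha>23"
    unfolding C1 C2 w1 by (simp add: algebra_simps)
      (unfold C1 row_sums(1) C5 w1, simp add: algebra_simps)
  have a: "a (Suc n) = (C1 - C2) * a n + C2 * b n + \<alpha>1" for n
    unfolding coeffs unfolding C2
    using rec_a[rule_format, of "Suc n"] by (simp add: c algebra_simps)
  have b: "b (Suc n) = C5 * a n + (C1 - C5) * b n + \<alpha>2" for n
    unfolding coeffs unfolding C5
    using rec_b[rule_format, of "Suc n"] by (simp add: c algebra_simps)
  \<comment> \<open>\<open>C4\<close> is the sum \<open>C2 + C5\<close>, hence it vanishes exactly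
    when \<open>C1 = C3\<close>.\<close>
  have C3': "C3 = C1 - C2 - C5" and C4': "C4 = C1 - C3"
    unfolding coeffs(1) C3 C4 C5 by (simp_all add: C1 w1 algebra_simps)
  note solution = equal_row_sum_system_solution[where a = a and b = b, OF a b C3']
  show ?thesis
  \<comment> \<open>Goals 3 and 5 are the side claims \<open>C3 \<noteq> 1\<close> and
    \<open>C1 \<noteq> 1\<close>.\<close>
  proof (intro conjI impI, goal_cases)
    case 1
    show ?case by (rule c)
  next
    case 2
    then have "C1 \<noteq> C3" "C1 \<noteq> 1" "C3 \<noteq> 1" by (auto simp: C4')
    note solution = solution[OF responses_distinct[OF this]]
    show ?case
      by (intro allI conjI; rule trans[OF solution(1)] trans[OF solution(2)])
         (simp_all add: C4')
  next
    case 3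
    then show ?case by (auto simp: C4')
  next
    case 4
    then have ne: "C3 \<noteq> 1" and eq: "C1 = 1" by (auto simp: C4')
    note solution = solution[unfolded eq, OF responses_first_one[OF ne]]
    show ?case
      by (intro allI conjI impI; rule trans[OF solution(1)] trans[OF solution(2)])
         (simp_all add: C4' eq)
  next
    case 5
    then show ?case by (auto simp: C4')
  next
    case 6
    then have ne: "C1 \<noteq> 1" and eq: "C3 = 1" by (auto simp: C4')
    note solution = solution[unfolded eq, OF responses_second_one[OF ne]]
    show ?case
      by (intro allI conjI impI; rule trans[OF solution(1)] trans[OF solution(2)])
         (simp_all add: C4' eq)
  next
    case 7
    then have ne: "C1 \<noteq> 1" and eq: "C3 = C1" by (auto simp: C4')
    note solution = solution[unfolded eq, OF responses_double[OF ne]]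
    show ?case
      by (intro allI conjI impI; rule trans[OF solution(1)] trans[OF solution(2)])
         \<comment> \<open>The condition x \<ge> 1 or \<open>C1 \<noteq> 0\<close> discharges the
           premise of \<open>powi_diff_one\<close>.\<close>
         (simp_all only: powi_diff_one, simp_all add: mult_ac)
  next
    case 8
    then have eq: "C1 = 1" "C3 = 1" by (auto simp: C4')
    note solution = solution[unfolded eq, OF responses_double_one]
    show ?case
      by (intro allI conjI impI; rule trans[OF solution(1)] trans[OF solution(2)])
         (simp_all add: eq algebra_simps)
  qed
qed

end
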